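(* Let $M=(E,\mathcal I)$ be a matroid on a finite ground set $E$, let $w:E\to\mathbb R$ be a weight function, let $E_0\subset E$ contain a basis of $M$, and let $T=|E\setminus E_0|$. Then the greedy algorithm described in the context finds an optimal solution of the problem IMD-MWB for $(M,w,E_0)$. That is, for any output $(e'_1,\ldots,e'_k)$ of the algorithm, the sets $A_0=\emptyset$, $A_i=\{e'_1,\ldots,e'_i\}$ for $1\leqslant i\leqslant k$, and $A_i=A_{i-1}+e'$ with an arbitrary $e'\in E\setminus(E_0\cup A_{i-1})$ for $k+1\leqslant i\leqslant T$, form an optimal solution of $$\min\left\{\sum_{i=0}^T f(A_i)\ :\ A_0=\emptyset,\ |A_i\setminus A_{i-1}|=1\text{ for }i=1,\ldots,T\right\}.$$
   Context: For a set $A$ and an element $e$ write $A+e=A\cup\{e\}$ and $A-e=A\setminus\{e\}$. The weight function is extended to subsets by $w(X)=\sum_{e\in X}w(e)$. For $A\subseteq E\setminus E_0$ let $$f(A)=\min\{w(X)\ :\ X\subseteq E_0\cup A\text{ is a basis of }M\}.$$ The incremental matroid design problem with minimum weight bases (IMD-MWB) with time horizon $T=|E\setminus E_0|$ is the displayed minimization problem in the claim, where the $A_i$ are subsets of $E\setminus E_0$. For a basis $X$ of $M$, a pair $(e,e')\in X\times(E\setminus X)$ is an exchange pair for $X$ if $X-e+e'$ is a basis; it is an optimal exchange pair for $X$ if $w(e)-w(e')$ is maximum among all exchange pairs for $X$. Greedy algorithm: Set $k\leftarrow 0$, let $w^*$ be the minimum weight of a basis of $M$, and let $X$ be any minimum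 weight basis of the submatroid induced by $E_0$ (which is also a basis of $M$). While $w(X)>w^*$: set $k\leftarrow k+1$; choose an optimal exchange pair $(e,e')$ for $X$; set $X\leftarrow X-e+e'$; set $e'_k\leftarrow e'$. Return $(e'_1,\ldots,e'_k)$. *)

theory Defs
  imports Complex_Main
begin

locale matroid =
  fixes E :: "'a set" and I :: "'a set set"
  assumes finite_ground: "finite E"
    and indep_subset_ground: "X \<in> I \<Longrightarrow> X \<subseteq> E"
    and empty_indep: "{} \<in> I"
    and hereditary: "X \<in> I \<Longrightarrow> Y \<subseteq> X \<Longrightarrow> Y \<in> I"
    and augmentation: "X \<in> I \<Longrightarrow> Y \<in> I \<Longrightarrow> card X < card Y \<Longrightarrow> \<exists>y\<in>Y - X. insert y X \<in> I"

definition basis :: "'a set set \<Rightarrow> 'a set \<Rightarrow> bool" where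
  "basis I X \<longleftrightarrow> X \<in> I \<and> (\<forall>Y\<in>I. X \<subseteq> Y \<longrightarrow> Y = X)"

definition induced_indep :: "'a set set \<Rightarrow> 'a set \<Rightarrow> 'a set set" where
  "induced_indep I S = {X \<in> I. X \<subseteq> S}"

definition min_weight_basis :: "'a set set \<Rightarrow> ('a \<Rightarrow> real) \<Rightarrow> 'a set \<Rightarrow> bool" where
  "min_weight_basis I w X \<longleftrightarrow> basis I X \<and> (\<forall>Y. basis I Y \<longrightarrow> sum w X \<le> sum w Y)"

definition min_basis_weight :: "'a set set \<Rightarrow> ('a \<Rightarrow> real) \<Rightarrow> real" where
  "min_basis_weight I w = Min {sum w X | X. basis I X}"

definition imd_cost :: "'a set set \<Rightarrow> ('a \<Rightarrow> real) \<Rightarrow> 'a set \<Rightarrow> 'a set \<Rightarrow> real" where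
  "imd_cost I w E0 A = Min {sum w X | X. X \<subseteq> E0 \<union> A \<and> basis I X}"

text \<open>
  A candidate solution \<open>A\<^sub>0, \<dots>, A\<^sub>T\<close> is a function on \<open>nat\<close> of which only the
  values at \<open>0, \<dots>, T\<close> matter. Consecutive sets are not required to be nested.
\<close>

definition imd_feasible :: "'a set \<Rightarrow> 'a set \<Rightarrow> (nat \<Rightarrow> 'a set) \<Rightarrow> bool" where
  "imd_feasible E E0 A \<longleftrightarrow>
     (\<forall>i\<le>card (E - E0). A i \<subseteq> E - E0) \<and> A 0 = {} \<and>
     (\<forall>i\<in>{1..card (E - E0)}. card (A i - A (i - 1)) = 1)"

definition imd_objective ::
  "'a set \<Rightarrow> 'a set set \<Rightarrow> ('a \<Rightarrow> real) \<Rightarrow> 'a set \<Rightarrow> (nat \<Rightarrow> 'a set) \<Rightarrow> real" where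
  "imd_objective E I w E0 A = (\<Sum>i=0..card (E - E0). imd_cost I w E0 (A i))"

definition imd_optimal ::
  "'a set \<Rightarrow> 'a set set \<Rightarrow> ('a \<Rightarrow> real) \<Rightarrow> 'a set \<Rightarrow> (nat \<Rightarrow> 'a set) \<Rightarrow> bool" where
  "imd_optimal E I w E0 A \<longleftrightarrow>
     imd_feasible E E0 A \<and>
     (\<forall>B. imd_feasible E E0 B \<longrightarrow> imd_objective E I w E0 A \<le> imd_objective E I w E0 B)"

definition exchange_pair :: "'a set \<Rightarrow> 'a set set \<Rightarrow> 'a set \<Rightarrow> 'a \<Rightarrow> 'a \<Rightarrow> bool" where
  "exchange_pair E I X e e' \<longleftrightarrow> e \<in> X \<and> e' \<in> E - X \<and> basis I (insert e' (X - {e}))"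

definition optimal_exchange_pair ::
  "'a set \<Rightarrow> 'a set set \<Rightarrow> ('a \<Rightarrow> real) \<Rightarrow> 'a set \<Rightarrow> 'a \<Rightarrow> 'a \<Rightarrow> bool" where
  "optimal_exchange_pair E I w X e e' \<longleftrightarrow>
     exchange_pair E I X e e' \<and>
     (\<forall>d d'. exchange_pair E I X d d' \<longrightarrow> w d - w d' \<le> w e - w e')"

text \<open>
  A state \<open>(X, es)\<close> of the greedy algorithm consists of the current basis and the list
  \<open>[e'\<^sub>1, \<dots>, e'\<^sub>k]\<close> of elements inserted so far; one step is one iteration of the while loop.
  The algorithm is nondeterministic: the initial basis and the exchange pairs are arbitrary
  subject to their defining conditions.
\<close>

definition greedy_init :: "'a set set \<Rightarrow> ('a \<Rightarrow> real) \<Rightarrow> 'a set \<Rightarrow> 'a set \<times> 'a list \<Rightarrow> bool" where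
  "greedy_init I w E0 s \<longleftrightarrow> min_weight_basis (induced_indep I E0) w (fst s) \<and> snd s = []"

inductive greedy_step ::
  "'a set \<Rightarrow> 'a set set \<Rightarrow> ('a \<Rightarrow> real) \<Rightarrow> 'a set \<times> 'a list \<Rightarrow> 'a set \<times> 'a list \<Rightarrow> bool"
  for E I w where
  "sum w X > min_basis_weight I w \<Longrightarrow> optimal_exchange_pair E I w X e e' \<Longrightarrow>
     greedy_step E I w (X, es) (insert e' (X - {e}), es @ [e'])"

definition greedy_reachable ::
  "'a set \<Rightarrow> 'a set set \<Rightarrow> ('a \<Rightarrow> real) \<Rightarrow> 'a set \<Rightarrow> 'a set \<times> 'a list \<Rightarrow> bool" where
  "greedy_reachable E I w E0 s \<longleftrightarrow>
     (\<exists>s0. greedy_init I w E0 s0 \<and> (greedy_step E I w)\<^sup>*\<^sup>* s0 s)"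

definition greedy_output ::
  "'a set \<Rightarrow> 'a set set \<Rightarrow> ('a \<Rightarrow> real) \<Rightarrow> 'a set \<Rightarrow> 'a list \<Rightarrow> bool" where
  "greedy_output E I w E0 es \<longleftrightarrow>
     (\<exists>X. greedy_reachable E I w E0 (X, es) \<and> \<not> sum w X > min_basis_weight I w)"

text \<open>
  The algorithm can be started, whenever the loop condition holds there is an optimal exchange
  pair to choose, and no execution is infinite.
\<close>

definition greedy_terminates ::
  "'a set \<Rightarrow> 'a set set \<Rightarrow> ('a \<Rightarrow> real) \<Rightarrow> 'a set \<Rightarrow> bool" where
  "greedy_terminates E I w E0 \<longleftrightarrow>
     (\<exists>s. greedy_init I w E0 s) \<and>
     (\<forall>X es. greedy_reachable E I w E0 (X, es) \<and> sum w X > min_basis_weight I w \<longrightarrow>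
        (\<exists>e e'. optimal_exchange_pair E I w X e e')) \<and>
     \<not> (\<exists>s. greedy_init I w E0 (s 0) \<and> (\<forall>n::nat. greedy_step E I w (s n) (s (Suc n))))"

definition greedy_solution ::
  "'a set \<Rightarrow> 'a set \<Rightarrow> 'a list \<Rightarrow> (nat \<Rightarrow> 'a set) \<Rightarrow> bool" where
  "greedy_solution E E0 es A \<longleftrightarrow>
     A 0 = {} \<and>
     (\<forall>i\<in>{1..length es}. A i = set (take i es)) \<and>
     (\<forall>i\<in>{length es + 1..card (E - E0)}.
        \<exists>e'\<in>E - (E0 \<union> A (i - 1)). A i = insert e' (A (i - 1)))"

end

theory Submission
  imports Defs
begin

text \<open>
  Penalise the elements outside \<open>E0\<close> by \<open>c \<ge> 0\<close>. A basis \<open>X\<close> that is minimal for the penalised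
  weight minimises \<open>w\<close> among all bases with at most \<open>card (X - E0)\<close> elements outside \<open>E0\<close>. The
  initial basis is minimal for large \<open>c\<close>. If \<open>X\<close> is minimal for some \<open>c\<close> and the optimal
  exchange gains \<open>g > 0\<close>, then this exchange must replace an element of \<open>E0\<close> by one outside \<open>E0\<close>,
  and \<open>g \<le> c\<close>. No exchange improves \<open>X\<close> for the penalty \<open>g\<close>, so \<open>X\<close> is minimal for \<open>g\<close>; the
  new basis has the same \<open>g\<close>-penalised weight and is minimal as well. Hence after \<open>i\<close> steps the
  greedy algorithm attains the minimum of the cost over all sets of at most \<open>i\<close> elements, which
  bounds every feasible sequence termwise.
\<close>

definition penalized :: "'a set \<Rightarrow> ('a \<Rightarrow> real) \<Rightarrow> real \<Rightarrow> 'a \<Rightarrow> real" where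
  "penalized S w c x = w x + (if x \<in> S then 0 else c)"

lemma sum_penalized:
  assumes "finite X"
  shows "sum (penalized S w c) X = sum w X + c * real (card (X - S))"
proof -
  have "(\<Sum>x\<in>X. if x \<in> S then 0 else c) = (\<Sum>x\<in>X - S. c)"
    using assms by (intro sum.mono_neutral_cong_right) auto
  then show ?thesis
    by (simp add: penalized_def sum.distrib)
qed

context matroid
begin

section \<open>Extension and exchange of bases\<close>

lemma finite_indep: "X \<in> I \<Longrightarrow> finite X"
  using finite_ground indep_subset_ground finite_subset by blast

lemma basis_indep: "basis I X \<Longrightarrow> X \<in> I"
  by (simp add: basis_def)

lemma basis_subset_ground: "basis I X \<Longrightarrow> X \<subseteq> E"
  by (simp add: basis_indep indep_subset_ground)

lemma finite_basis: "basis I X \<Longrightarrow> finite X"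
  by (simp add: basis_indep finite_indep)

lemma finite_bases: "finite {X. basis I X}"
  by (rule finite_subset[of _ "Pow E"])
    (use finite_ground basis_subset_ground in auto)

lemma finite_basis_weights: "finite {sum w X | X. P X \<and> basis I X}"
  by (rule finite_subset[of _ "sum w ` {X. basis I X}"]) (use finite_bases in auto)

text \<open>Repeated augmentation from \<open>Y\<close>. The bound
  \<open>K \<subseteq> J \<union> Y\<close> is what later keeps \<open>K\<close> inside a prescribed
  set.\<close>

lemma indep_extend:
  assumes "J \<in> I" "Y \<in> I" "card J \<le> card Y"
  shows "\<exists>K\<in>I. J \<subseteq> K \<and> K \<subseteq> J \<union> Y \<and> card K = card Y"
  using assms
proof (induction "card Y - card J" arbitrary: J)
  case 0
  then show ?case by auto
next
  case (Suc n)
  then have "card J < card Y" by simp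
  then obtain y where y: "y \<in> Y - J" "insert y J \<in> I"
    using augmentation Suc.prems by blast
  have "card (insert y J) = Suc (card J)"
    using y Suc.prems finite_indep by simp
  then have "\<exists>K\<in>I. insert y J \<subseteq> K \<and> K \<subseteq> insert y J \<union> Y \<and> card K = card Y"
    using Suc y by (intro Suc.hyps(1)) auto
  then show ?case using y by blast
qed

lemma card_indep_le_basis:
  assumes "basis I X" "Y \<in> I"
  shows "card Y \<le> card X"
proof (rule ccontr)
  assume "\<not> card Y \<le> card X"
  then obtain y where "y \<in> Y - X" "insert y X \<in> I"
    using assms augmentation[of X Y] by (auto simp: basis_def)
  then show False using assms(1) by (auto simp: basis_def)
qed

lemma basis_card_eq: "basis I X \<Longrightarrow> basis I Y \<Longrightarrow> card X = card Y"
  by (meson basis_def card_indep_le_basis order_antisym)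

lemma basisI_card:
  assumes "basis I X" "Y \<in> I" "card X \<le> card Y"
  shows "basis I Y"
  unfolding basis_def
proof (intro conjI ballI impI)
  fix Z assume Z: "Z \<in> I" "Y \<subseteq> Z"
  then have "card Z \<le> card Y"
    using assms card_indep_le_basis[of X Z] by simp
  then show "Z = Y"
    using Z finite_indep card_seteq by metis
qed (fact assms)

text \<open>Using elements of \<open>B\<close>, an independent subset of \<open>S\<close> extends to
  the size of \<open>B\<close> without leaving \<open>S\<close>; maximality within \<open>S\<close>
  therefore forces it to have that size already.\<close>

lemma basis_induced_indep_iff:
  assumes "basis I B" "B \<subseteq> S"
  shows "basis (induced_indep I S) X \<longleftrightarrow> basis I X \<and> X \<subseteq> S"
proof
  assume X: "basis (induced_indep I S) X"
  then have XI: "X \<in> I" "X \<subseteq> S" by (auto simp: basis_def induced_indep_def)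
  have "B \<in> I" "card X \<le> card B"
    using assms(1) XI(1) basis_indep card_indep_le_basis by simp_all
  then obtain K where K: "K \<in> I" "X \<subseteq> K" "K \<subseteq> X \<union> B" "card K = card B"
    using indep_extend XI by blast
  then have "K \<in> induced_indep I S"
    using XI(2) assms(2) by (auto simp: induced_indep_def)
  then have "K = X"
    using K(2) X by (auto simp: basis_def)
  then show "basis I X \<and> X \<subseteq> S"
    using K XI assms basisI_card[of B X] by simp
next
  assume "basis I X \<and> X \<subseteq> S"
  then show "basis (induced_indep I S) X"
    by (simp add: basis_def induced_indep_def)
qed

text \<open>Extending \<open>insert m (X \<inter> Y)\<close> by elements of \<open>Y\<close> to the
  size of \<open>Y\<close> yields \<open>Y\<close> with \<open>m\<close> added and exactly one
  \<open>d\<close> missing; \<open>d\<close> lies outside \<open>X\<close> because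
  \<open>X \<inter> Y\<close> was retained.\<close>

lemma basis_exchange:
  assumes "basis I X" "basis I Y" "m \<in> X - Y"
  obtains d where "d \<in> Y - X" "basis I (insert m (Y - {d}))"
proof -
  let ?J = "insert m (X \<inter> Y)"
  have XY: "X \<in> I" "Y \<in> I" "card X = card Y"
    using basis_indep[OF assms(1)] basis_indep[OF assms(2)] basis_card_eq[OF assms(1,2)] .
  have JX: "?J \<subseteq> X" using assms(3) by auto
  have J: "?J \<in> I" "card ?J \<le> card Y"
    using hereditary[OF XY(1) JX] card_mono[OF finite_indep[OF XY(1)] JX] XY(3) by simp_all
  obtain K where K: "K \<in> I" "?J \<subseteq> K" "K \<subseteq> ?J \<union> Y" "card K = card Y"
    using indep_extend[OF J(1) XY(2) J(2)] by blast
  have fin: "finite Y" "finite K" using XY K finite_indep by auto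
  have "Y \<noteq> K" using K(2) assms(3) by auto
  then have "\<not> Y \<subseteq> K"
    using card_subset_eq[OF fin(2)] K(4) by metis
  then obtain d where d: "d \<in> Y" "d \<notin> K" by blast
  have "K \<subseteq> insert m (Y - {d})" using K d by auto
  moreover have "card (insert m (Y - {d})) = card K"
    using K(4) d(1) assms(3) card_Suc_Diff1[OF fin(1) d(1)] fin(1) by simp
  ultimately have "K = insert m (Y - {d})"
    using fin by (intro card_subset_eq) auto
  moreover have "basis I K"
    using K assms basisI_card by simp
  ultimately show thesis
    using that d K by auto
qed

section \<open>Local optimality under exchanges implies global optimality\<close>

lemma sum_exchange:
  fixes v :: "'a \<Rightarrow> real"
  assumes "finite X" "e \<in> X" "e' \<notin> X"
  shows "sum v (insert e' (X - {e})) = sum v X - v e + v e'"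
  using assms by (simp add: sum_diff1)

lemma min_weight_basis_exchange:
  assumes "min_weight_basis I v X" "exchange_pair E I X e e'"
  shows "v e \<le> v e'"
proof -
  have "sum v X \<le> sum v (insert e' (X - {e}))"
    using assms by (auto simp: min_weight_basis_def exchange_pair_def)
  moreover have "finite X"
    using assms finite_basis by (auto simp: min_weight_basis_def)
  ultimately show ?thesis
    using assms by (simp add: exchange_pair_def sum_exchange sum_diff1)
qed

text \<open>Any other basis \<open>Y\<close> can be moved one element closer to \<open>X\<close>
  without increasing its weight.\<close>

lemma min_weight_basisI_exchange:
  assumes X: "basis I X"
    and loc: "\<And>e e'. exchange_pair E I X e e' \<Longrightarrow> v e \<le> v e'"
  shows "min_weight_basis I v X"
proof -
  have "sum v X \<le> sum v Y" if "basis I Y" for Y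
    using that
  proof (induction "card (Y - X)" arbitrary: Y rule: less_induct)
    case less
    note Y = \<open>basis I Y\<close>
    have fin: "finite X" "finite Y" using X Y finite_basis by auto
    have cXY: "card X = card Y" by (rule basis_card_eq[OF X Y])
    show ?case
    proof (cases "X = Y")
      case False
      then have ne: "X - Y \<noteq> {}"
        using cXY fin card_subset_eq[of Y X] by auto
      \<comment> \<open>The lightest candidate is chosen since the partner \<open>e\<close> found
        below cannot be prescribed, yet has to be at least as heavy as \<open>m\<close>.\<close>
      obtain m where m: "m \<in> X - Y" and m_min: "\<And>x. x \<in> X - Y \<Longrightarrow> v m \<le> v x"
        using ne fin arg_min_if_finite[of "X - Y" v] by (metis finite_Diff not_le)
      obtain d where d: "d \<in> Y - X" "basis I (insert m (Y - {d}))"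
        using basis_exchange[OF X Y m] .
      \<comment> \<open>Exchanging in the reverse direction puts \<open>d\<close> into
        \<open>X\<close>, so local optimality applies:
        \<open>v m \<le> v e \<le> v d\<close>.\<close>
      obtain e where e: "e \<in> X - Y" "basis I (insert d (X - {e}))"
        using basis_exchange[OF Y X d(1)] .
      have "exchange_pair E I X e d"
        using e d Y basis_subset_ground by (auto simp: exchange_pair_def)
      then have "v m \<le> v d" using loc m_min[OF e(1)] by force
      moreover have "insert m (Y - {d}) - X = (Y - X) - {d}"
        using m by auto
      then have "card (insert m (Y - {d}) - X) < card (Y - X)"
        using d fin by (metis card_Diff1_less finite_Diff)
      then have "sum v X \<le> sum v (insert m (Y - {d}))"
        using less d by blast
      ultimately show ?thesis
        using d m fin by (simp add: sum_exchange sum_diff1)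
    qed simp
  qed
  then show ?thesis using X by (simp add: min_weight_basis_def)
qed

section \<open>Attained minima of basis weights\<close>

lemma ex_min_weight_basis:
  fixes w :: "'a \<Rightarrow> real"
  assumes "\<exists>X. basis I X \<and> P X"
  obtains X where "basis I X" "P X" "\<And>Y. basis I Y \<Longrightarrow> P Y \<Longrightarrow> sum w X \<le> sum w Y"
proof -
  let ?S = "{X. basis I X \<and> P X}"
  have "finite ?S" using finite_bases by (rule rev_finite_subset) auto
  moreover have "?S \<noteq> {}" using assms by auto
  ultimately show thesis
    using arg_min_if_finite[of ?S "sum w"] that by (metis (mono_tags, lifting) mem_Collect_eq not_le)
qed

lemma min_basis_weight_le: "basis I X \<Longrightarrow> min_basis_weight I w \<le> sum w X"
  unfolding min_basis_weight_def using finite_basis_weights[of w "\<lambda>_. True"]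
  by (intro Min_le) auto

lemma min_weight_basis_weight:
  "min_weight_basis I w X \<Longrightarrow> sum w X = min_basis_weight I w"
  unfolding min_basis_weight_def min_weight_basis_def
  using finite_basis_weights[of w "\<lambda>_. True"]
  by (intro Min_eqI[symmetric]) auto

lemma imd_cost_le: "basis I X \<Longrightarrow> X \<subseteq> E0 \<union> A \<Longrightarrow> imd_cost I w E0 A \<le> sum w X"
  unfolding imd_cost_def by (intro Min_le finite_basis_weights) auto

lemma imd_cost_attained:
  assumes "\<exists>X. basis I X \<and> X \<subseteq> E0"
  obtains X where "basis I X" "X \<subseteq> E0 \<union> A" "imd_cost I w E0 A = sum w X"
proof -
  have "imd_cost I w E0 A \<in> {sum w X | X. X \<subseteq> E0 \<union> A \<and> basis I X}"
    unfolding imd_cost_def using assms by (intro Min_in finite_basis_weights) blast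
  then show thesis using that by blast
qed

section \<open>Bases minimal for a penalised weight\<close>

lemma min_weight_basis_large_penalty:
  assumes X: "basis I X" "X \<subseteq> S"
    and min: "\<And>Y. basis I Y \<Longrightarrow> Y \<subseteq> S \<Longrightarrow> sum w X \<le> sum w Y"
  obtains c where "c \<ge> 0" "min_weight_basis I (penalized S w c) X"
proof
  \<comment> \<open>This bounds the difference between the weights of any two bases, so a single
    element outside \<open>S\<close> costs at least what a basis could gain.\<close>
  let ?c = "2 * (\<Sum>x\<in>E. \<bar>w x\<bar>)"
  show c0: "?c \<ge> 0" by (simp add: sum_nonneg)
  have bound: "\<bar>sum w Y\<bar> \<le> (\<Sum>x\<in>E. \<bar>w x\<bar>)" if "basis I Y" for Y
  proof -
    have "\<bar>sum w Y\<bar> \<le> (\<Sum>x\<in>Y. \<bar>w x\<bar>)" by (rule sum_abs)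
    also have "\<dots> \<le> (\<Sum>x\<in>E. \<bar>w x\<bar>)"
      using that basis_subset_ground finite_ground by (intro sum_mono2) auto
    finally show ?thesis .
  qed
  have "sum w X \<le> sum w Y + ?c * real (card (Y - S))" if Y: "basis I Y" for Y
  proof (cases "Y \<subseteq> S")
    case True
    then show ?thesis using min Y c0 by (simp add: add_increasing2)
  next
    case False
    then have "card (Y - S) \<noteq> 0" using Y finite_basis by auto
    then have "?c * 1 \<le> ?c * real (card (Y - S))"
      using c0 by (intro mult_left_mono) auto
    then show ?thesis using bound[OF Y] bound[OF X(1)] by linarith
  qed
  then have "sum w X \<le> sum (penalized S w ?c) Y" if "basis I Y" for Y
    using that by (simp add: sum_penalized finite_basis)
  moreover have "sum (penalized S w ?c) X = sum w X"
    using X(2) by (intro sum.cong) (auto simp: penalized_def)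
  ultimately show "min_weight_basis I (penalized S w ?c) X"
    using X(1) unfolding min_weight_basis_def by simp
qed

lemma min_weight_basis_penalized_le:
  assumes "min_weight_basis I (penalized S w c) X" "c \<ge> 0"
    and "basis I Y" "card (Y - S) \<le> card (X - S)"
  shows "sum w X \<le> sum w Y"
proof -
  have "sum (penalized S w c) X \<le> sum (penalized S w c) Y"
    using assms by (simp add: min_weight_basis_def)
  moreover have "finite X" "finite Y"
    using assms finite_basis by (auto simp: min_weight_basis_def)
  moreover have "c * real (card (Y - S)) \<le> c * real (card (X - S))"
    using assms by (intro mult_left_mono) auto
  ultimately show ?thesis by (simp add: sum_penalized)
qed

lemma ex_optimal_exchange_pair:
  assumes X: "basis I X" and gt: "sum w X > min_basis_weight I w"
  obtains e e' where "optimal_exchange_pair E I w X e e'" "w e > w e'"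
proof -
  let ?P = "{(e, e'). exchange_pair E I X e e'}"
  have "\<not> min_weight_basis I w X" using gt min_weight_basis_weight by auto
  then obtain d d' where d: "exchange_pair E I X d d'" "w d > w d'"
    using min_weight_basisI_exchange[OF X, of w] not_le by blast
  have "finite ?P"
    by (rule finite_subset[of _ "X \<times> E"])
      (use X finite_basis finite_ground in \<open>auto simp: exchange_pair_def\<close>)
  moreover have "?P \<noteq> {}" using d by auto
  ultimately obtain p where p: "p \<in> ?P"
    and max: "\<And>q. q \<in> ?P \<Longrightarrow> w (snd p) - w (fst p) \<le> w (snd q) - w (fst q)"
    using arg_min_if_finite[of ?P "\<lambda>q. w (snd q) - w (fst q)"] by (metis (lifting) not_le)
  show thesis
  proof (rule that)
    show "optimal_exchange_pair E I w X (fst p) (snd p)"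
      using p max by (force simp: optimal_exchange_pair_def)
    show "w (fst p) > w (snd p)"
      using max[of "(d, d')"] d by simp
  qed
qed

text \<open>The gain of the optimal exchange is the penalty at which \<open>X\<close> and its
  successor tie; it becomes the next penalty.\<close>

lemma penalized_optimal_exchange:
  assumes X: "min_weight_basis I (penalized S w c) X" and c: "c \<ge> 0"
    and gt: "sum w X > min_basis_weight I w"
    and opt: "optimal_exchange_pair E I w X e e'"
  shows "e \<in> X" "e \<in> S" "e' \<in> E - X" "e' \<notin> S" "w e > w e'"
    "min_weight_basis I (penalized S w (w e - w e')) (insert e' (X - {e}))"
proof -
  let ?g = "w e - w e'"
  let ?X' = "insert e' (X - {e})"
  have basX: "basis I X" using X by (simp add: min_weight_basis_def)
  have ex: "exchange_pair E I X e e'" using opt by (simp add: optimal_exchange_pair_def)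
  then show eX: "e \<in> X" and e'X: "e' \<in> E - X" by (auto simp: exchange_pair_def)
  \<comment> \<open>Positivity of the gain comes from comparison with an exchange that improves
    \<open>w\<close>.\<close>
  obtain d d' where "optimal_exchange_pair E I w X d d'" "w d > w d'"
    using ex_optimal_exchange_pair[OF basX gt] .
  then show g: "w e > w e'"
    using opt unfolding optimal_exchange_pair_def by force
  have "penalized S w c e \<le> penalized S w c e'"
    by (rule min_weight_basis_exchange[OF X ex])
  \<comment> \<open>A positive gain in \<open>w\<close> that is no improvement for penalty
    \<open>c\<close> is possible only if \<open>e'\<close> pays the penalty and \<open>e\<close>
    does not; then \<open>w e \<le> w e' + c\<close>.\<close>
  with c g have eS: "e \<in> S" and e'S: "e' \<notin> S" and gc: "?g \<le> c"
    by (auto simp: penalized_def split: if_splits)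
  then show "e \<in> S" "e' \<notin> S" by simp_all
  have "min_weight_basis I (penalized S w ?g) X"
  proof (rule min_weight_basisI_exchange[OF basX])
    fix d d' assume d: "exchange_pair E I X d d'"
    have "w d - w d' \<le> ?g"
      using opt d by (simp add: optimal_exchange_pair_def)
    moreover have "penalized S w c d \<le> penalized S w c d'"
      by (rule min_weight_basis_exchange[OF X d])
    \<comment> \<open>If \<open>d\<close> is in \<open>S\<close> and \<open>d'\<close> is not,
      maximality of \<open>?g\<close> suffices. In the opposite case
      \<open>w d + c \<le> w d'\<close> and \<open>?g \<le> c\<close> do. Otherwise the penalties
      cancel.\<close>
    ultimately show "penalized S w ?g d \<le> penalized S w ?g d'"
      using gc by (auto simp: penalized_def split: if_splits)
  qed
  moreover have "sum (penalized S w ?g) ?X' = sum (penalized S w ?g) X"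
    using eX e'X eS e'S finite_basis[OF basX] by (simp add: sum_exchange sum_diff1 penalized_def)
  ultimately show "min_weight_basis I (penalized S w ?g) ?X'"
    using ex by (simp add: min_weight_basis_def exchange_pair_def)
qed

section \<open>Invariant and termination of the greedy algorithm\<close>

text \<open>Earlier bases are not part of the state, so they survive as witnesses \<open>Z\<close>,
  one for each prefix of \<open>es\<close>. Their optimality is stated for \<open>w\<close> under a
  bound on the elements outside \<open>E0\<close>, because the penalty \<open>c\<close> may change
  from step to step.\<close>

definition greedy_invariant :: "('a \<Rightarrow> real) \<Rightarrow> 'a set \<Rightarrow> 'a set \<times> 'a list \<Rightarrow> bool" where
  "greedy_invariant w E0 = (\<lambda>(X, es).
     (\<exists>c\<ge>0. min_weight_basis I (penalized E0 w c) X) \<and> distinct es \<and> X - E0 = set es \<and>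
     (\<forall>i\<le>length es. \<exists>Z. basis I Z \<and> Z - E0 = set (take i es) \<and>
        (\<forall>Y. basis I Y \<longrightarrow> card (Y - E0) \<le> i \<longrightarrow> sum w Z \<le> sum w Y)))"

text \<open>For the full list \<open>X\<close> itself is the witness, by
  \<open>min_weight_basis_penalized_le\<close>; only proper prefixes have to be supplied.\<close>

lemma greedy_invariantI:
  assumes "min_weight_basis I (penalized E0 w c) X" "c \<ge> 0" "distinct es" "X - E0 = set es"
    and "\<And>i. i < length es \<Longrightarrow> \<exists>Z. basis I Z \<and> Z - E0 = set (take i es) \<and>
        (\<forall>Y. basis I Y \<longrightarrow> card (Y - E0) \<le> i \<longrightarrow> sum w Z \<le> sum w Y)"
  shows "greedy_invariant w E0 (X, es)"
proof -
  have "sum w X \<le> sum w Y" if "basis I Y" "card (Y - E0) \<le> length es" for Y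
    using min_weight_basis_penalized_le[OF assms(1,2)] that assms(3,4)
    by (simp add: distinct_card)
  moreover have "basis I X" using assms(1) by (simp add: min_weight_basis_def)
  ultimately have last: "\<exists>Z. basis I Z \<and> Z - E0 = set (take (length es) es) \<and>
        (\<forall>Y. basis I Y \<longrightarrow> card (Y - E0) \<le> length es \<longrightarrow> sum w Z \<le> sum w Y)"
    using assms(4) by auto
  show ?thesis
    unfolding greedy_invariant_def using assms last by (auto simp: le_less)
qed

lemma greedy_invariant_init:
  assumes "\<exists>B. basis I B \<and> B \<subseteq> E0" and init: "greedy_init I w E0 s"
  shows "greedy_invariant w E0 s"
proof -
  obtain X where s: "s = (X, [])" and X: "min_weight_basis (induced_indep I E0) w X"
    using init by (cases s) (auto simp: greedy_init_def)
  obtain B where "basis I B" "B \<subseteq> E0" using assms by blast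
  note iff = basis_induced_indep_iff[OF this]
  obtain c where "c \<ge> 0" "min_weight_basis I (penalized E0 w c) X"
    using X min_weight_basis_large_penalty[of X E0 w] by (auto simp: min_weight_basis_def iff)
  then show ?thesis
    unfolding s using X by (intro greedy_invariantI) (auto simp: min_weight_basis_def iff)
qed

lemma greedy_invariant_step:
  assumes "greedy_step E I w s s'" "greedy_invariant w E0 s"
  shows "greedy_invariant w E0 s'"
  using assms(1)
proof cases
  case (1 X e e' es)
  have inv: "greedy_invariant w E0 (X, es)" using assms(2) 1(1) by simp
  then obtain c where c: "min_weight_basis I (penalized E0 w c) X" "c \<ge> 0"
    by (auto simp: greedy_invariant_def)
  note ex = penalized_optimal_exchange[OF c 1(3,4)]
  have set_es: "X - E0 = set es" "distinct es" using inv by (auto simp: greedy_invariant_def)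
  show ?thesis
    unfolding 1(2)
  proof (rule greedy_invariantI[OF ex(6)])
    show "0 \<le> w e - w e'" using ex by simp
    \<comment> \<open>Since \<open>e\<close> lies in \<open>E0\<close> and \<open>e'\<close> outside
      both \<open>E0\<close> and \<open>X\<close>, the inserted element is new and no earlier one is
      removed.\<close>
    show "distinct (es @ [e'])" using ex set_es by auto
    show "insert e' (X - {e}) - E0 = set (es @ [e'])" using ex set_es by auto
    \<comment> \<open>Here \<open>i \<le> length es\<close>, so the old witness for this prefix is
      reused.\<close>
    show "\<exists>Z. basis I Z \<and> Z - E0 = set (take i (es @ [e'])) \<and>
        (\<forall>Y. basis I Y \<longrightarrow> card (Y - E0) \<le> i \<longrightarrow> sum w Z \<le> sum w Y)"
      if "i < length (es @ [e'])" for i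
      using that inv by (auto simp: greedy_invariant_def)
  qed
qed

lemma greedy_invariant_reachable:
  assumes "\<exists>B. basis I B \<and> B \<subseteq> E0" "greedy_reachable E I w E0 s"
  shows "greedy_invariant w E0 s"
proof -
  obtain s0 where "greedy_init I w E0 s0" "(greedy_step E I w)\<^sup>*\<^sup>* s0 s"
    using assms(2) by (auto simp: greedy_reachable_def)
  from this(2,1) show ?thesis
    by (induction rule: rtranclp_induct)
      (use assms(1) greedy_invariant_init greedy_invariant_step in blast)+
qed

lemma greedy_invariant_set:
  assumes "greedy_invariant w E0 (X, es)"
  shows "distinct es" "set es \<subseteq> E - E0" "length es \<le> card (E - E0)"
proof -
  show "distinct es" using assms by (simp add: greedy_invariant_def)
  have "X \<subseteq> E" "X - E0 = set es"
    using assms basis_subset_ground by (auto simp: greedy_invariant_def min_weight_basis_def)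
  then show *: "set es \<subseteq> E - E0" by auto
  then have "card (set es) \<le> card (E - E0)" using finite_ground by (intro card_mono) auto
  then show "length es \<le> card (E - E0)" using \<open>distinct es\<close> by (simp add: distinct_card)
qed

text \<open>Every step lengthens the list of inserted elements, while the invariant bounds its
  length by \<open>card (E - E0)\<close>.\<close>

lemma greedy_terminates:
  assumes "\<exists>B. basis I B \<and> B \<subseteq> E0"
  shows "greedy_terminates E I w E0"
  unfolding greedy_terminates_def
proof (intro conjI allI impI)
  obtain B where B: "basis I B" "B \<subseteq> E0" using assms by blast
  obtain X where "basis I X" "X \<subseteq> E0"
    "\<And>Y. basis I Y \<Longrightarrow> Y \<subseteq> E0 \<Longrightarrow> sum w X \<le> sum w Y"
    using ex_min_weight_basis[OF assms, of w] by blast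
  then have "greedy_init I w E0 (X, [])"
    by (simp add: greedy_init_def min_weight_basis_def basis_induced_indep_iff[OF B])
  then show "\<exists>s. greedy_init I w E0 s" ..
next
  fix X es assume *: "greedy_reachable E I w E0 (X, es) \<and> min_basis_weight I w < sum w X"
  then have "basis I X"
    using greedy_invariant_reachable[OF assms]
    by (fastforce simp: greedy_invariant_def min_weight_basis_def)
  then show "\<exists>e e'. optimal_exchange_pair E I w X e e'"
    using * ex_optimal_exchange_pair by blast
next
  show "\<not> (\<exists>s. greedy_init I w E0 (s 0) \<and> (\<forall>n::nat. greedy_step E I w (s n) (s (Suc n))))"
  proof
    assume "\<exists>s. greedy_init I w E0 (s 0) \<and> (\<forall>n::nat. greedy_step E I w (s n) (s (Suc n)))"
    then obtain s where s: "greedy_init I w E0 (s 0)"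
      "\<And>n::nat. greedy_step E I w (s n) (s (Suc n))" by blast
    have inv: "greedy_invariant w E0 (s n)" for n
      by (induction n) (use s assms greedy_invariant_init greedy_invariant_step in blast)+
    have "length (snd (s n)) = n" for n
    proof (induction n)
      case 0
      then show ?case using s(1) by (simp add: greedy_init_def)
    next
      case (Suc n)
      then show ?case using s(2)[of n] by (auto elim!: greedy_step.cases)
    qed
    then show False
      using greedy_invariant_set(3)[of w E0 "fst (s n)" "snd (s n)" for n] inv
      by (metis Suc_n_not_le_n prod.collapse)
  qed
qed

section \<open>Feasibility and optimality of the resulting sequences\<close>

lemma greedy_solution_feasible:
  assumes inv: "greedy_invariant w E0 (X, es)" and sol: "greedy_solution E E0 es A"
  shows "imd_feasible E E0 A"
    and "\<And>i. i \<le> length es \<Longrightarrow> A i = set (take i es)"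
    and "\<And>i. length es \<le> i \<Longrightarrow> i \<le> card (E - E0) \<Longrightarrow> set es \<subseteq> A i"
proof -
  note es = greedy_invariant_set[OF inv]
  have A0: "A 0 = {}"
    and A_late: "\<And>i. length es < i \<Longrightarrow> i \<le> card (E - E0) \<Longrightarrow>
      \<exists>e'\<in>E - (E0 \<union> A (i - 1)). A i = insert e' (A (i - 1))"
    using sol by (auto simp: greedy_solution_def)
  show A_early: "A i = set (take i es)" if "i \<le> length es" for i
    using sol that by (cases "i = 0") (auto simp: greedy_solution_def)
  have step: "\<exists>e'\<in>E - (E0 \<union> A i). A (Suc i) = insert e' (A i)" if "i < card (E - E0)" for i
  proof (cases "i < length es")
    case True
    then have "es ! i \<in> E - E0" using es(2) nth_mem by blast
    moreover have "es ! i \<notin> set (take i es)"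
      using es(1) True by (auto simp: in_set_conv_nth nth_eq_iff_index_eq)
    moreover have "set (take (Suc i) es) = insert (es ! i) (set (take i es))"
      using True by (simp add: take_Suc_conv_app_nth)
    ultimately show ?thesis using True A_early[of i] A_early[of "Suc i"] by auto
  next
    case False
    then show ?thesis using A_late[of "Suc i"] that by simp
  qed
  have sub: "A i \<subseteq> E - E0" if "i \<le> card (E - E0)" for i
    using that
  proof (induction i)
    case (Suc i)
    then show ?case using step[of i] by auto
  qed (simp add: A0)
  have "card (A i - A (i - 1)) = 1" if "i \<in> {1..card (E - E0)}" for i
  proof -
    obtain j where "i = Suc j" using \<open>i \<in> _\<close> by (cases i) auto
    with that have "j < card (E - E0)" by simp
    then obtain e' where "e' \<notin> A j" "A (Suc j) = insert e' (A j)"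
      using step by blast
    then have "A (Suc j) - A j = {e'}" by auto
    with \<open>i = Suc j\<close> show ?thesis by simp
  qed
  then show "imd_feasible E E0 A"
    using sub A0 by (simp add: imd_feasible_def)
  show "set es \<subseteq> A i" if "length es \<le> i" "i \<le> card (E - E0)" for i
    using that
  proof (induction rule: dec_induct)
    case base
    then show ?case using A_early[of "length es"] by simp
  next
    case (step n)
    then show ?case using A_late[of "Suc n"] by auto
  qed
qed

text \<open>Elements may be dropped from one set to the next, but only one new element arrives each
  time.\<close>

lemma card_imd_feasible:
  assumes "imd_feasible E E0 B" "i \<le> card (E - E0)"
  shows "card (B i) \<le> i"
  using assms(2)
proof (induction i)
  case 0
  then show ?case using assms(1) by (simp add: imd_feasible_def)
next
  case (Suc i)
  have "B i \<subseteq> E - E0"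
    using assms(1) Suc.prems by (simp add: imd_feasible_def)
  then have "finite (B i)"
    using finite_ground by (meson finite_Diff finite_subset)
  then have "card (B (Suc i)) - card (B i) \<le> card (B (Suc i) - B i)"
    by (rule diff_card_le_card_Diff)
  moreover have "Suc i \<in> {1..card (E - E0)}" using Suc.prems by simp
  then have "card (B (Suc i) - B (Suc i - 1)) = 1"
    using assms(1) unfolding imd_feasible_def by blast
  ultimately show ?case using Suc by simp
qed

text \<open>The comparison is termwise: a cheapest basis for \<open>B i\<close> has at most
  \<open>i\<close> elements outside \<open>E0\<close>, and the greedy witness for \<open>i\<close>
  is no heavier.\<close>

lemma greedy_solution_optimal:
  assumes ex: "\<exists>B. basis I B \<and> B \<subseteq> E0"
    and out: "greedy_output E I w E0 es" and sol: "greedy_solution E E0 es A"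
  shows "imd_optimal E I w E0 A"
proof -
  obtain X where reach: "greedy_reachable E I w E0 (X, es)" and X: "sum w X \<le> min_basis_weight I w"
    using out by (auto simp: greedy_output_def)
  note inv = greedy_invariant_reachable[OF ex reach]
  note A = greedy_solution_feasible[OF inv sol]
  have "imd_cost I w E0 (A i) \<le> imd_cost I w E0 (B i)"
    if B: "imd_feasible E E0 B" and i: "i \<le> card (E - E0)" for B i
  proof -
    obtain Y where Y: "basis I Y" "Y \<subseteq> E0 \<union> B i" "imd_cost I w E0 (B i) = sum w Y"
      using imd_cost_attained[OF ex] .
    have "B i \<subseteq> E - E0" using B i by (simp add: imd_feasible_def)
    then have "finite (B i)" using finite_ground finite_subset by blast
    then have "card (Y - E0) \<le> card (B i)" using Y by (intro card_mono) auto
    also have "\<dots> \<le> i" by (rule card_imd_feasible[OF B i])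
    finally have card_Y: "card (Y - E0) \<le> i" .
    have "\<exists>Z. basis I Z \<and> Z \<subseteq> E0 \<union> A i \<and> sum w Z \<le> sum w Y"
    proof (cases "i \<le> length es")
      case True
      then obtain Z where "basis I Z" "Z - E0 = set (take i es)" "sum w Z \<le> sum w Y"
        using inv Y(1) card_Y by (auto simp: greedy_invariant_def)
      then show ?thesis using A(2)[OF True] by blast
    next
      \<comment> \<open>Past the end of the output, \<open>X\<close> has minimum weight among all
        bases and stays available because \<open>A i\<close> contains \<open>set es\<close>.\<close>
      case False
      then have "set es \<subseteq> A i" using A(3) i by simp
      moreover have "basis I X" "X - E0 = set es"
        using inv by (auto simp: greedy_invariant_def min_weight_basis_def)
      moreover have "sum w X \<le> sum w Y"
        using X min_basis_weight_le[OF Y(1), of w] by simp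
      ultimately show ?thesis by blast
    qed
    then show ?thesis using imd_cost_le Y(3) by (metis order_trans)
  qed
  then show ?thesis
    using A(1) by (auto simp: imd_optimal_def imd_objective_def intro!: sum_mono)
qed

end

theorem theorem1:
  fixes E E0 :: "'a set" and I :: "'a set set" and w :: "'a \<Rightarrow> real"
  assumes "matroid E I"
    and "E0 \<subseteq> E"
    and "\<exists>X. basis I X \<and> X \<subseteq> E0"
  shows "greedy_terminates E I w E0 \<and>
    (\<forall>es. greedy_output E I w E0 es \<longrightarrow>
       length es \<le> card (E - E0) \<and>
       (\<forall>A. greedy_solution E E0 es A \<longrightarrow> imd_optimal E I w E0 A))"
proof -
  interpret matroid E I by fact
  have ex: "\<exists>B. basis I B \<and> B \<subseteq> E0" by fact
  show ?thesis
  proof (intro conjI allI impI)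
    show "greedy_terminates E I w E0" by (rule greedy_terminates[OF ex])
    fix es assume out: "greedy_output E I w E0 es"
    then show "length es \<le> card (E - E0)"
      using greedy_invariant_reachable[OF ex] greedy_invariant_set(3)
      unfolding greedy_output_def by blast
    fix A assume "greedy_solution E E0 es A"
    with ex out show "imd_optimal E I w E0 A" by (rule greedy_solution_optimal)
  qed
qed

end
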